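(* Let $X$ be a real Banach space and $D\subseteq X$. Let $A:D\to 2^X$ with $0\in Aq$ be uniformly accretive at zero with modulus $\Theta$, and let $A_n:D\to 2^X$ ($n\in\mathbb{N}$) be a sequence of operators which uniformly approximates $A$ with rate $\mu$. Let $(\alpha_i)$ be a sequence of nonnegative reals such that $\sum_{i=0}^\infty\alpha_i=\infty$ with rate of divergence $r$, and suppose that $(x_n)$ and $(u_n)$ are sequences satisfying $x_n\in D$ and $$x_{n+1}=x_n-\alpha_n u_n,\qquad u_n\in A_n x_{n+1}$$ for all $n\in\mathbb{N}$. Finally, suppose $K,K'\in(0,\infty)$ satisfy $\|x_n-q\|<K$ for all $n\in\mathbb{N}$ and $\|q\|<K'$. Then $\|x_n-q\|\to 0$ with rate of convergence $$\Phi_{\Theta,\mu,r,K,K'}(\varepsilon):=r\left(\mu_{K+K'}\left(\frac{\Theta_K(\varepsilon)}{2K}\right),\frac{K^2}{\Theta_K(\varepsilon)}\right)+1 .$$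
   Context: $\mathbb{N}=\{0,1,2,\ldots\}$. $X$ is a real Banach space with dual $X^\ast$; the normalized duality mapping $J:X\to 2^{X^\ast}$ is $J(x):=\{j\in X^\ast : \langle x,j\rangle=\|x\|^2=\|j\|^2\}$. An operator on $X$ is a mapping $A:X\to 2^X$, with domain $D(A):=\{x\in X: Ax\neq\emptyset\}$; $(x,u)\in A$ means $u\in Ax$. $A$ is accretive if for all $u\in Ax$ and $v\in Ay$ there exists $j\in J(x-y)$ with $\langle u-v,j\rangle\geq 0$. An accretive operator $A:D(A)\to 2^X$ with $0\in Aq$ is uniformly accretive at zero if for all $\varepsilon,K>0$ there exists $\delta>0$ such that $$(\ast)\quad \forall (x,u)\in A\ \big(\|x-q\|\in[\varepsilon,K]\to \exists j\in J(x-q)\ (\langle u,j\rangle\geq\delta)\big).$$ A function $\Theta_{(\cdot)}(\cdot):(0,\infty)\times(0,\infty)\to(0,\infty)$ such that $\delta:=\Theta_K(\varepsilon)$ satisfies $(\ast)$ for all $\varepsilon,K>0$ is called a modulus of uniform accretivity at zero for $A$. For $P,Q\subseteq X$ and $a>0$, $H^\ast[P,Q,a]$ means: $\forall u\in P\ \exists v\in Q\ (\|u-v\|\leq a)$. For operators $A$ and $A_n:D\to 2^X$ with $D(A)=D(A_n)=D$, $(A_n)$ uniformly approximates $A$ with rate (of uniform approximation) $\mu_{(\cdot)}(\cdot):(0,\infty)\times(0,\infty)\to\mathbb{N}$ if $$\forall K,\varepsilon>0\ \forall n\geq\mu_K(\varepsilon)\ \forall x\in D\ \big(\|x\|\leq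 K\to H^\ast[A_nx,Ax,\varepsilon]\big).$$ A rate of convergence for a sequence of nonnegative reals $a_n\to 0$ is a function $\phi:(0,\infty)\to\mathbb{N}$ with $\forall\varepsilon>0\ \forall n\geq\phi(\varepsilon)\ (a_n\leq\varepsilon)$. A rate (or modulus) of divergence for $\sum_{i=0}^\infty\alpha_i=\infty$ (with $\alpha_i\ge 0$) is a function $r:\mathbb{N}\times(0,\infty)\to\mathbb{N}$ with $\sum_{i=N}^{r(N,x)}\alpha_i\geq x$ for all $N\in\mathbb{N}$, $x>0$, where $\sum_{i=N}^m\alpha_i=0$ if $m<N$. *)

theory Defs
  imports "HOL-Analysis.Analysis"
begin

text \<open>The dual of X is the type of bounded linear functionals, normed by the operator norm.\<close>

definition duality_map :: "'a::real_normed_vector \<Rightarrow> ('a \<Rightarrow>\<^sub>L real) set" where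
  "duality_map x = {j. blinfun_apply j x = (norm x)\<^sup>2 \<and> (norm x)\<^sup>2 = (norm j)\<^sup>2}"

definition op_dom :: "('a \<Rightarrow> 'a set) \<Rightarrow> 'a set" where
  "op_dom A = {x. A x \<noteq> {}}"

definition accretive :: "('a::real_normed_vector \<Rightarrow> 'a set) \<Rightarrow> bool" where
  "accretive A \<longleftrightarrow>
     (\<forall>x y. \<forall>u\<in>A x. \<forall>v\<in>A y. \<exists>j\<in>duality_map (x - y). blinfun_apply j (u - v) \<ge> 0)"

definition accretivity_bound ::
  "('a::real_normed_vector \<Rightarrow> 'a set) \<Rightarrow> 'a \<Rightarrow> real \<Rightarrow> real \<Rightarrow> real \<Rightarrow> bool" where
  "accretivity_bound A q \<epsilon> K \<delta> \<longleftrightarrow>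
     (\<forall>x. \<forall>u\<in>A x. norm (x - q) \<in> {\<epsilon>..K} \<longrightarrow>
        (\<exists>j\<in>duality_map (x - q). blinfun_apply j u \<ge> \<delta>))"

definition uniformly_accretive_at_zero ::
  "('a::real_normed_vector \<Rightarrow> 'a set) \<Rightarrow> 'a \<Rightarrow> bool" where
  "uniformly_accretive_at_zero A q \<longleftrightarrow>
     accretive A \<and> 0 \<in> A q \<and>
     (\<forall>\<epsilon>>0. \<forall>K>0. \<exists>\<delta>>0. accretivity_bound A q \<epsilon> K \<delta>)"

text \<open>
  Functions defined on positive reals are total functions here; only their values at positive
  arguments are constrained. The subscript is the first argument: \<open>\<Theta> K \<epsilon>\<close> and \<open>\<mu> K \<epsilon>\<close>.
\<close>

definition modulus_uniform_accretivity ::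
  "(real \<Rightarrow> real \<Rightarrow> real) \<Rightarrow> ('a::real_normed_vector \<Rightarrow> 'a set) \<Rightarrow> 'a \<Rightarrow> bool" where
  "modulus_uniform_accretivity \<Theta> A q \<longleftrightarrow>
     (\<forall>\<epsilon>>0. \<forall>K>0. \<Theta> K \<epsilon> > 0 \<and> accretivity_bound A q \<epsilon> K (\<Theta> K \<epsilon>))"

definition Hstar :: "'a::real_normed_vector set \<Rightarrow> 'a set \<Rightarrow> real \<Rightarrow> bool" where
  "Hstar P Q a \<longleftrightarrow> (\<forall>u\<in>P. \<exists>v\<in>Q. norm (u - v) \<le> a)"

definition uniformly_approximates_with_rate ::
  "'a::real_normed_vector set \<Rightarrow> (nat \<Rightarrow> 'a \<Rightarrow> 'a set) \<Rightarrow> ('a \<Rightarrow> 'a set) \<Rightarrow>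
     (real \<Rightarrow> real \<Rightarrow> nat) \<Rightarrow> bool" where
  "uniformly_approximates_with_rate D An A \<mu> \<longleftrightarrow>
     op_dom A = D \<and> (\<forall>n. op_dom (An n) = D) \<and>
     (\<forall>K>0. \<forall>\<epsilon>>0. \<forall>n\<ge>\<mu> K \<epsilon>. \<forall>x\<in>D. norm x \<le> K \<longrightarrow> Hstar (An n x) (A x) \<epsilon>)"

definition rate_of_convergence :: "(real \<Rightarrow> nat) \<Rightarrow> (nat \<Rightarrow> real) \<Rightarrow> bool" where
  "rate_of_convergence \<phi> a \<longleftrightarrow> (\<forall>\<epsilon>>0. \<forall>n\<ge>\<phi> \<epsilon>. a n \<le> \<epsilon>)"

definition rate_of_divergence :: "(nat \<Rightarrow> real \<Rightarrow> nat) \<Rightarrow> (nat \<Rightarrow> real) \<Rightarrow> bool" where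
  "rate_of_divergence r \<alpha> \<longleftrightarrow> (\<forall>N. \<forall>x>0. (\<Sum>i=N..r N x. \<alpha> i) \<ge> x)"

end

theory Submission
  imports Defs
begin

text \<open>
  Write \<open>a\<^sub>n\<close> for the norm of \<open>x\<^sub>n - q\<close> and \<open>\<delta>\<close> for \<open>\<Theta> K \<epsilon>\<close>. Past the index supplied by \<open>\<mu>\<close>, \<open>u\<^sub>n\<close> is
  within \<open>\<delta> / (2 * K)\<close> of a value of \<open>A\<close> at \<open>x\<^sub>n\<^sub>+\<^sub>1\<close>, so testing the recursion with the functional
  provided by accretivity shows that \<open>a\<^sub>n\<^sub>+\<^sub>1 \<ge> \<epsilon>\<close> forces the square of \<open>a\<close> to drop by at least \<open>\<alpha>\<^sub>n \<delta>\<close>.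
  The total drop is less than \<open>K\<^sup>2\<close>, so \<open>a\<close> falls below \<open>\<epsilon>\<close> as soon as the \<open>\<alpha>\<^sub>n\<close> have summed to
  \<open>K\<^sup>2 / \<delta>\<close>; it cannot rise above \<open>\<epsilon>\<close> again, since it does not increase at any step ending above \<open>\<epsilon>\<close>.
\<close>

lemma bounded_by_threshold_after_descent:
  fixes a \<alpha> :: "nat \<Rightarrow> real" and \<epsilon> \<delta> K :: real and N M n :: nat
  assumes a_nonneg: "\<And>n. 0 \<le> a n" and aN: "a N < K"
    and \<alpha>_nonneg: "\<And>n. 0 \<le> \<alpha> n" and \<delta>: "0 < \<delta>"
    and descent: "\<And>n. N \<le> n \<Longrightarrow> \<epsilon> \<le> a (Suc n) \<Longrightarrow> (a (Suc n))\<^sup>2 \<le> (a n)\<^sup>2 - \<alpha> n * \<delta>"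
    and mass: "K\<^sup>2 / \<delta> \<le> (\<Sum>i=N..M. \<alpha> i)"
    and n: "Suc M \<le> n"
  shows "a n \<le> \<epsilon>"
proof -
  have "0 < K"
    using a_nonneg[of N] aN by linarith
  have "\<exists>m\<in>{N..M}. a (Suc m) < \<epsilon>"
  proof (rule ccontr)
    assume "\<not> ?thesis"
    then have "\<alpha> m * \<delta> \<le> (a m)\<^sup>2 - (a (Suc m))\<^sup>2" if "m \<in> {N..M}" for m
      using descent[of m] that by force
    then have sum_le: "(\<Sum>i=N..M. \<alpha> i) * \<delta> \<le> (\<Sum>i=N..M. (a i)\<^sup>2 - (a (Suc i))\<^sup>2)"
      unfolding sum_distrib_right by (rule sum_mono)
    have "K\<^sup>2 \<le> (\<Sum>i=N..M. \<alpha> i) * \<delta>"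
      using mass \<delta> by (simp add: pos_divide_le_eq)
    \<comment> \<open>For \<open>M < N\<close> the sum of the \<open>\<alpha> i\<close> would be
      empty, hence 0, and could not dominate the positive \<open>K\<^sup>2\<close>.\<close>
    moreover have "N \<le> M"
    proof (rule ccontr)
      assume "\<not> N \<le> M"
      then show False
        using calculation \<open>0 < K\<close> by simp
    qed
    \<comment> \<open>Telescoping; the squares enter negated because they are subtracted in
      decreasing order.\<close>
    then have "(\<Sum>i=N..M. (a i)\<^sup>2 - (a (Suc i))\<^sup>2) = (a N)\<^sup>2 - (a (Suc M))\<^sup>2"
      using sum_Suc_diff[of N M "\<lambda>i. - (a i)\<^sup>2"] by simp
    moreover have "(a N)\<^sup>2 < K\<^sup>2"
      using aN a_nonneg by (simp add: power_strict_mono)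
    ultimately show False
      using sum_le zero_le_power2[of "a (Suc M)"] by linarith
  qed
  then obtain m where m: "N \<le> m" "m \<le> M" "a (Suc m) < \<epsilon>"
    by auto
  \<comment> \<open>The small term sits at \<open>Suc m\<close>, possibly as late as
    \<open>Suc M\<close>: hence the \<open>+ 1\<close> in the rate.\<close>
  have "Suc m \<le> n"
    using m n by simp
  then show ?thesis
  proof (induction n rule: dec_induct)
    case base
    show ?case using m by simp
  next
    case (step k)
    show ?case
    proof (rule ccontr)
      assume above: "\<not> a (Suc k) \<le> \<epsilon>"
      then have "(a (Suc k))\<^sup>2 \<le> (a k)\<^sup>2 - \<alpha> k * \<delta>"
        using descent[of k] m step by simp
      \<comment> \<open>So a step ending above \<epsilon> must also have started above \<epsilon>,
        against the induction hypothesis.\<close>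
      then have "(a (Suc k))\<^sup>2 \<le> (a k)\<^sup>2"
        using mult_nonneg_nonneg[of "\<alpha> k" \<delta>] \<alpha>_nonneg[of k] \<delta> by linarith
      then have "a (Suc k) \<le> a k"
        using a_nonneg by (rule power2_le_imp_le)
      then show False
        using above step by simp
    qed
  qed
qed

text \<open>The functional \<open>j\<close> belongs to the new point \<open>y\<close>, where the
  implicit scheme evaluates the operator. Replacing \<open>v\<close> by \<open>u\<close> costs half
  of \<delta>; the other half becomes a full \<delta> when the estimate is doubled to pass from a
  product of norms to squares.\<close>

lemma implicit_step_norm_descent:
  fixes q x y u v :: "'a::real_normed_vector"
  assumes step: "y = x - \<alpha> *\<^sub>R u" and \<alpha>: "0 \<le> \<alpha>" and K: "0 < K" and \<delta>: "0 < \<delta>"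
    and near: "norm (u - v) \<le> \<delta> / (2 * K)"
    and j: "j \<in> duality_map (y - q)" "\<delta> \<le> blinfun_apply j v"
    and bound: "norm (y - q) \<le> K"
  shows "(norm (y - q))\<^sup>2 \<le> (norm (x - q))\<^sup>2 - \<alpha> * \<delta>"
proof -
  have jy: "blinfun_apply j (y - q) = (norm (y - q))\<^sup>2" and "(norm (y - q))\<^sup>2 = (norm j)\<^sup>2"
    using j(1) by (auto simp: duality_map_def)
  then have nj: "norm j = norm (y - q)"
    by (simp add: power2_eq_iff_nonneg)
  have j_le: "blinfun_apply j z \<le> norm (y - q) * norm z" for z
    using norm_blinfun[of j z] nj by simp
  have "blinfun_apply j (v - u) \<le> norm (y - q) * norm (v - u)"
    by (rule j_le)
  \<comment> \<open>The tolerance is chosen to cancel the bound \<open>K\<close> on the norm of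
    \<open>j\<close>.\<close>
  also have "\<dots> \<le> K * (\<delta> / (2 * K))"
    using bound near K by (intro mult_mono) (auto simp: norm_minus_commute)
  also have "\<dots> = \<delta> / 2"
    using K by simp
  finally have "\<delta> / 2 \<le> blinfun_apply j u"
    using j(2) by (simp add: blinfun.diff_right)
  then have ju: "\<alpha> * (\<delta> / 2) \<le> \<alpha> * blinfun_apply j u"
    using \<alpha> by (rule mult_left_mono)
  have "y - q = (x - q) - \<alpha> *\<^sub>R u"
    using step by simp
  then have "blinfun_apply j (y - q) = blinfun_apply j (x - q) - \<alpha> * blinfun_apply j u"
    by (simp only: blinfun.diff_right blinfun.scaleR_right real_scaleR_def)
  then have "(norm (y - q))\<^sup>2 \<le> norm (y - q) * norm (x - q) - \<alpha> * (\<delta> / 2)"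
    using jy j_le[of "x - q"] ju by linarith
  moreover have "2 * norm (y - q) * norm (x - q) \<le> (norm (y - q))\<^sup>2 + (norm (x - q))\<^sup>2"
    by (rule sum_squares_bound)
  ultimately show ?thesis
    by simp
qed

lemma rate_of_convergence_imp_tendsto_zero:
  assumes "rate_of_convergence \<phi> a" and "\<And>n. 0 \<le> a n"
  shows "a \<longlonglongrightarrow> 0"
proof (rule LIMSEQ_I)
  fix e :: real
  assume "0 < e"
  \<comment> \<open>Halving turns the weak inequality of a rate into a strict one.\<close>
  then have "\<forall>n\<ge>\<phi> (e / 2). a n \<le> e / 2"
    using assms(1) unfolding rate_of_convergence_def by (meson half_gt_zero)
  then have "\<forall>n\<ge>\<phi> (e / 2). norm (a n - 0) < e"
    using assms(2) \<open>0 < e\<close> by fastforce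
  then show "\<exists>N. \<forall>n\<ge>N. norm (a n - 0) < e" ..
qed

theorem theorem5p6:
  fixes D :: "'a::banach set"
    and A :: "'a \<Rightarrow> 'a set"
    and An :: "nat \<Rightarrow> 'a \<Rightarrow> 'a set"
    and q :: 'a
    and \<Theta> :: "real \<Rightarrow> real \<Rightarrow> real"
    and \<mu> :: "real \<Rightarrow> real \<Rightarrow> nat"
    and \<alpha> :: "nat \<Rightarrow> real"
    and r :: "nat \<Rightarrow> real \<Rightarrow> nat"
    and x u :: "nat \<Rightarrow> 'a"
    and K K' :: real
  assumes "op_dom A = D"
    and "0 \<in> A q"
    and "uniformly_accretive_at_zero A q"
    and "modulus_uniform_accretivity \<Theta> A q"
    and "\<And>n. op_dom (An n) = D"
    and "uniformly_approximates_with_rate D An A \<mu>"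
    and "\<And>i. \<alpha> i \<ge> 0"
    and "filterlim (\<lambda>n. \<Sum>i\<le>n. \<alpha> i) at_top sequentially"
    and "rate_of_divergence r \<alpha>"
    and "\<And>n. x n \<in> D"
    and "\<And>n. x (Suc n) = x n - \<alpha> n *\<^sub>R u n"
    and "\<And>n. u n \<in> An n (x (Suc n))"
    and "K > 0" and "K' > 0"
    and "\<And>n. norm (x n - q) < K"
    and "norm q < K'"
  shows "(\<lambda>n. norm (x n - q)) \<longlonglongrightarrow> 0 \<and>
    rate_of_convergence
      (\<lambda>\<epsilon>. r (\<mu> (K + K') (\<Theta> K \<epsilon> / (2 * K))) (K\<^sup>2 / \<Theta> K \<epsilon>) + 1)
      (\<lambda>n. norm (x n - q))"
proof -
  let ?\<phi> = "\<lambda>\<epsilon>. r (\<mu> (K + K') (\<Theta> K \<epsilon> / (2 * K))) (K\<^sup>2 / \<Theta> K \<epsilon>) + 1"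
  have rate: "rate_of_convergence ?\<phi> (\<lambda>n. norm (x n - q))"
    unfolding rate_of_convergence_def
  proof (intro allI impI)
    fix \<epsilon> :: real and n :: nat
    assume \<epsilon>: "\<epsilon> > 0" and n: "n \<ge> ?\<phi> \<epsilon>"
    define \<delta> where "\<delta> = \<Theta> K \<epsilon>"
    define N where "N = \<mu> (K + K') (\<delta> / (2 * K))"
    have \<delta>: "0 < \<delta>" and acc: "accretivity_bound A q \<epsilon> K \<delta>"
      using assms(4) \<epsilon> \<open>K > 0\<close> by (auto simp: modulus_uniform_accretivity_def \<delta>_def)
    \<comment> \<open>The rate \<mu> is indexed by the distance to 0, not to \<open>q\<close>, hence
      the subscript \<open>K + K'\<close>.\<close>
    have bound: "norm (x m) \<le> K + K'" for m
      using norm_triangle_ineq[of "x m - q" q] assms(15)[of m] assms(16) by simp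
    have approx: "\<exists>v\<in>A (x (Suc m)). norm (u m - v) \<le> \<delta> / (2 * K)" if "N \<le> m" for m
    proof -
      have "0 < K + K'" "0 < \<delta> / (2 * K)"
        using \<delta> \<open>K > 0\<close> \<open>K' > 0\<close> by auto
      then have "Hstar (An m (x (Suc m))) (A (x (Suc m))) (\<delta> / (2 * K))"
        using assms(6,10) bound that
        unfolding uniformly_approximates_with_rate_def N_def by blast
      then show ?thesis
        using assms(12) by (simp add: Hstar_def)
    qed
    show "norm (x n - q) \<le> \<epsilon>"
    proof (rule bounded_by_threshold_after_descent[where N = N and \<delta> = \<delta> and K = K])
      fix m
      assume "N \<le> m" and far: "\<epsilon> \<le> norm (x (Suc m) - q)"
      obtain v where v: "v \<in> A (x (Suc m))" "norm (u m - v) \<le> \<delta> / (2 * K)"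
        using approx[OF \<open>N \<le> m\<close>] by blast
      have le: "norm (x (Suc m) - q) \<le> K"
        using assms(15)[of "Suc m"] by simp
      \<comment> \<open>Accretivity is used for \<open>A\<close> only, so \<open>j\<close> is
        controlled on \<open>v\<close> and not directly on \<open>u m\<close>.\<close>
      obtain j where "j \<in> duality_map (x (Suc m) - q)" "\<delta> \<le> blinfun_apply j v"
        using acc v(1) far le unfolding accretivity_bound_def by fastforce
      then show "(norm (x (Suc m) - q))\<^sup>2 \<le> (norm (x m - q))\<^sup>2 - \<alpha> m * \<delta>"
        using implicit_step_norm_descent[OF assms(11,7) \<open>K > 0\<close> \<delta> v(2)] le by blast
    next
      show "K\<^sup>2 / \<delta> \<le> (\<Sum>i=N..r N (K\<^sup>2 / \<delta>). \<alpha> i)"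
        using assms(9) \<delta> \<open>K > 0\<close> by (simp add: rate_of_divergence_def)
      show "Suc (r N (K\<^sup>2 / \<delta>)) \<le> n"
        using n by (simp add: N_def \<delta>_def)
    qed (use assms(7,15) \<delta> in auto)
  qed
  then show ?thesis
    using rate_of_convergence_imp_tendsto_zero[OF rate] by simp
qed

end
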